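(* Let $0<\lambda\le1$. Let $\phi$ be analytic on the closed unit disk $\overline{\mathbb D}$ (i.e. on an open neighbourhood of it), with $\phi(0)=0$ and $|\phi(z)|<1$ for $z\in\mathbb D$. Suppose that $\phi$ is not of the form $\phi(z)=e^{i\theta}z$ with $\theta\in\mathbb R$, and that there exists $\theta_0\in\mathbb R$ with $\phi(e^{i\theta_0})=-1$. Then the function $f$ defined by $$\frac{z}{f(z)}=1-(1+\lambda)\phi(z)+\lambda(\phi(z))^2,\quad z\in\mathbb D,$$ is not a member of $\mathcal U(\lambda)$.
   Context: $\mathbb D=\{z\in\mathbb C:|z|<1\}$ is the unit disk. $\mathcal A$ is the set of functions $f$ analytic in $\mathbb D$ with $f(0)=0$ and $f'(0)=1$. For $0<\lambda\le 1$, $\mathcal U(\lambda)$ is the set of all $f\in\mathcal A$ satisfying $$\left|\left(\frac{z}{f(z)}\right)^2f'(z)-1\right|<\lambda\quad\text{for all } z\in\mathbb D,$$ where $z/f(z)$ takes the value $1$ at $z=0$ (the condition includes that $f(z)\ne0$ for $z\in\mathbb D\setminus\{0\}$). *)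

theory Defs
  imports "HOL-Complex_Analysis.Complex_Analysis"
begin

definition class_A :: "(complex \<Rightarrow> complex) set" where
  "class_A = {f. f holomorphic_on ball 0 1 \<and> f 0 = 0 \<and> deriv f 0 = 1}"

(* z / f z, with the removable singularity at 0 filled by the value for f 0 = 0, f' 0 = 1 *)
definition z_over :: "(complex \<Rightarrow> complex) \<Rightarrow> complex \<Rightarrow> complex" where
  "z_over f z = (if z = 0 then 1 else z / f z)"

(* The nonvanishing of f is explicit because division by 0 is total in HOL. *)
definition class_U :: "real \<Rightarrow> (complex \<Rightarrow> complex) set" where
  "class_U lam = {f \<in> class_A.
     (\<forall>z \<in> ball 0 1 - {0}. f z \<noteq> 0) \<and>
     (\<forall>z \<in> ball 0 1. norm ((z_over f z)\<^sup>2 * deriv f z - 1) < lam)}"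

end

theory Submission
  imports Defs
begin

text \<open>
  Put \<open>g z = z / f z\<close>, so that \<open>(z / f z)\<^sup>2 f' z = g z - z g' z\<close>. If \<open>f\<close> were in the class, the
  inequality would persist by continuity, in its weak form, at the boundary point \<open>\<zeta>\<close> where
  \<open>\<phi> \<zeta> = -1\<close>. There the quantity to be bounded is \<open>1 + 2\<lambda> + (1 + 3\<lambda>) \<zeta> \<phi>' \<zeta>\<close>. A strict form of
  the boundary Schwarz lemma gives \<open>Re (\<zeta> \<phi>' \<zeta>) < -1\<close> unless \<open>\<phi>\<close> is a rotation, and then the
  real part is less than \<open>-\<lambda>\<close>.
\<close>

lemma one_minus_norm_Moebius_function:
  assumes "norm w < 1" "norm z < 1"
  shows "1 - (norm (Moebius_function 0 w z))\<^sup>2 =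
    (1 - (norm w)\<^sup>2) * (1 - (norm z)\<^sup>2) / (norm (1 - cnj w * z))\<^sup>2"
proof -
  have "norm (cnj w * z) < 1"
    using norm_mult_less[of "cnj w" 1 z 1] assms by simp
  then have nz: "1 - cnj w * z \<noteq> 0"
    by auto
  have "(norm (1 - cnj w * z))\<^sup>2 - (norm (z - w))\<^sup>2 = (1 - (norm w)\<^sup>2) * (1 - (norm z)\<^sup>2)"
    by (simp only: cmod_power2) (simp add: power2_eq_square algebra_simps)
  then show ?thesis
    using nz by (simp add: Moebius_function_simple norm_divide power_divide field_simps)
qed

text \<open>The Schwarz lemma is applied to \<open>f\<close> followed by the disk automorphism that
  sends \<open>f 0\<close> to 0. The denominator of the resulting identity is at least
  \<open>1 - norm (f 0)\<close>, and one such factor cancels. What matters later is that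
  \<open>1 - (norm (f z))\<^sup>2\<close> is at least a fixed positive multiple of
  \<open>1 - (norm z)\<^sup>2\<close>.\<close>

lemma Schwarz_Pick_origin:
  assumes holf: "f holomorphic_on ball 0 1"
    and lt1: "\<And>z. norm z < 1 \<Longrightarrow> norm (f z) < 1"
    and z: "norm z < 1"
  shows "(1 - norm (f 0)) * (1 - (norm z)\<^sup>2) \<le> (1 + norm (f 0)) * (1 - (norm (f z))\<^sup>2)"
proof -
  define a where "a = norm (f 0)"
  define T where "T = Moebius_function 0 (f 0) \<circ> f"
  have a: "0 \<le> a" "a < 1"
    using lt1[of 0] by (auto simp: a_def)
  have "T holomorphic_on ball 0 1"
    unfolding T_def using lt1
    by (intro holomorphic_on_compose_gen[OF holf Moebius_function_holomorphic]) auto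
  moreover have "T 0 = 0"
    by (simp add: T_def Moebius_function_eq_zero)
  moreover have "norm (T w) < 1" if "norm w < 1" for w
    using that lt1 by (simp add: T_def Moebius_function_norm_lt_1)
  ultimately have "norm (T z) \<le> norm z"
    using Schwarz_Lemma(1) z by blast
  then have "1 - (norm z)\<^sup>2 \<le> 1 - (norm (T z))\<^sup>2"
    by (simp add: power_mono)
  also have "\<dots> = (1 - a\<^sup>2) * (1 - (norm (f z))\<^sup>2) / (norm (1 - cnj (f 0) * f z))\<^sup>2"
    using lt1 z by (simp add: T_def a_def one_minus_norm_Moebius_function)
  also have "\<dots> \<le> (1 - a\<^sup>2) * (1 - (norm (f z))\<^sup>2) / (1 - a)\<^sup>2"
  proof (rule divide_left_mono)
    have "norm (cnj (f 0) * f z) \<le> a"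
      using lt1[OF z] mult_left_le[of "norm (f z)" a] a by (simp add: norm_mult a_def)
    then have "1 - a \<le> norm (1 - cnj (f 0) * f z)"
      using norm_triangle_ineq2[of 1 "cnj (f 0) * f z"] by simp
    then show le: "(1 - a)\<^sup>2 \<le> (norm (1 - cnj (f 0) * f z))\<^sup>2"
      using a by (simp add: power_mono)
    have "0 < (1 - a)\<^sup>2"
      using a by simp
    with le show "0 < (norm (1 - cnj (f 0) * f z))\<^sup>2 * (1 - a)\<^sup>2"
      by (intro mult_pos_pos) linarith+
    show "0 \<le> (1 - a\<^sup>2) * (1 - (norm (f z))\<^sup>2)"
      using a lt1[OF z] by (intro mult_nonneg_nonneg) (auto simp: abs_square_le_1)
  qed
  also have "\<dots> = (1 + a) * (1 - (norm (f z))\<^sup>2) / (1 - a)"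
  proof -
    have "1 - a\<^sup>2 = (1 - a) * (1 + a)"
      by (simp add: power2_eq_square algebra_simps)
    then show ?thesis
      using a by (simp add: power2_eq_square)
  qed
  finally show ?thesis
    using a by (simp add: a_def field_simps)
qed

text \<open>Rotations are the only equality cases of the Schwarz lemma. Excluding them makes the
  bound on the quotient strict everywhere, including the origin, where \<open>h 0\<close> is
  \<open>deriv f 0\<close>. Hence the Schwarz-Pick estimate applies to \<open>h\<close>.\<close>

lemma Schwarz_quotient_lt_1:
  assumes holf: "f holomorphic_on ball 0 1" and f0: "f 0 = 0"
    and lt1: "\<And>z. norm z < 1 \<Longrightarrow> norm (f z) < 1"
    and nrot: "\<nexists>\<alpha>. norm \<alpha> = 1 \<and> (\<forall>z. norm z < 1 \<longrightarrow> f z = \<alpha> * z)"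
  obtains h where "h holomorphic_on ball 0 1" "\<And>z. norm z < 1 \<Longrightarrow> f z = z * h z"
    "\<And>z. norm z < 1 \<Longrightarrow> norm (h z) < 1"
proof -
  obtain h where h: "h holomorphic_on ball 0 1" "\<And>z. norm z < 1 \<Longrightarrow> f z = z * h z"
      "deriv f 0 = h 0"
    using Schwarz3[OF holf f0] by blast
  note S = Schwarz_Lemma[OF holf f0 lt1]
  have strict: "norm (deriv f 0) \<noteq> 1" "\<And>z. norm z < 1 \<Longrightarrow> z \<noteq> 0 \<Longrightarrow> norm (f z) \<noteq> norm z"
    using S(3)[of 0] nrot by (auto; blast)+
  have "norm (h z) < 1" if z: "norm z < 1" for z
  proof (cases "z = 0")
    case True
    then show ?thesis
      using S(2)[of 0] strict(1) h(3) by simp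
  next
    case False
    then have "norm (f z) < norm z"
      using S(1)[of z] strict(2)[of z] z by simp
    then show ?thesis
      using False z by (simp add: h(2) norm_mult)
  qed
  with h that show thesis
    by blast
qed

text \<open>The argument runs along the radius to \<open>\<zeta>\<close>. Schwarz-Pick for the
  quotient \<open>h\<close> improves the Schwarz bound on \<open>f\<close> by an amount of first
  order in \<open>1 - r\<close>, so the radial derivative is at least \<open>1 + k\<close> with
  \<open>k > 0\<close>.\<close>

lemma boundary_Schwarz_strict:
  assumes holf: "f holomorphic_on ball 0 1" and f0: "f 0 = 0"
    and lt1: "\<And>z. norm z < 1 \<Longrightarrow> norm (f z) < 1"
    and nrot: "\<nexists>\<alpha>. norm \<alpha> = 1 \<and> (\<forall>z. norm z < 1 \<longrightarrow> f z = \<alpha> * z)"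
    and \<zeta>: "norm \<zeta> = 1" "norm (f \<zeta>) = 1"
    and der: "(f has_field_derivative d) (at \<zeta>)"
  shows "1 < Re (cnj (f \<zeta>) * (\<zeta> * d))"
proof -
  obtain h where h: "h holomorphic_on ball 0 1" "\<And>z. norm z < 1 \<Longrightarrow> f z = z * h z"
      "\<And>z. norm z < 1 \<Longrightarrow> norm (h z) < 1"
    using Schwarz_quotient_lt_1[OF holf f0 lt1 nrot] by blast
  \<comment> \<open>The ratio of the two factors in \<open>Schwarz_Pick_origin\<close> for
    \<open>h\<close>. It is positive because \<open>norm (h 0) < 1\<close>.\<close>
  define k where "k = (1 - norm (h 0)) / (1 + norm (h 0))"
  have k: "0 < k"
    using h(3)[of 0] by (simp add: k_def add_pos_nonneg)
  \<comment> \<open>A real part replaces the modulus of \<open>f\<close>: it is bounded by that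
    modulus, agrees with it at \<open>r = 1\<close>, and its derivative there is
    \<open>m\<close>.\<close>
  define H where "H r = Re (cnj (f \<zeta>) * f (of_real r * \<zeta>))" for r :: real
  \<comment> \<open>By the Schwarz-Pick bound for \<open>f z / z\<close>, \<open>B \<ge> 0\<close> to the left of \<open>1\<close>, while \<open>B 1 = 0\<close>.\<close>
  define B where "B r = r\<^sup>2 * (1 - k * (1 - r\<^sup>2)) - (H r)\<^sup>2" for r :: real
  define m where "m = Re (cnj (f \<zeta>) * (\<zeta> * d))"
  have "((\<lambda>z. cnj (f \<zeta>) * f (z * \<zeta>)) has_field_derivative cnj (f \<zeta>) * (\<zeta> * d)) (at (of_real 1))"
  proof -
    have "((\<lambda>z. z * \<zeta>) has_field_derivative \<zeta>) (at 1)"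
      by (auto intro!: derivative_eq_intros)
    then have "((\<lambda>z. f (z * \<zeta>)) has_field_derivative d * \<zeta>) (at 1)"
      using DERIV_chain2[of f d "\<lambda>z. z * \<zeta>" 1 \<zeta>] der by simp
    then show ?thesis
      using DERIV_cmult[of "\<lambda>z. f (z * \<zeta>)" "d * \<zeta>" 1 UNIV "cnj (f \<zeta>)"] by (simp add: ac_simps)
  qed
  then have H': "(H has_real_derivative m) (at 1)"
    unfolding H_def m_def by (intro has_field_derivative_Re has_vector_derivative_real_field)
  have H1: "H 1 = 1"
    using \<zeta>(2) by (simp add: H_def mult.commute[of "cnj _"] complex_norm_square[symmetric])
  have B1: "B 1 = 0"
    by (simp add: B_def H1)
  have B': "(B has_real_derivative 2 + 2 * k - 2 * m) (at 1)"
    unfolding B_def by (auto intro!: derivative_eq_intros H' simp: H1)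
  have Bpos: "0 \<le> B r" if r: "0 < r" "r < 1" for r
  proof -
    define z where "z = of_real r * \<zeta>"
    have z: "norm z = r"
      using r \<zeta>(1) by (simp add: z_def norm_mult)
    have "\<bar>H r\<bar> \<le> norm (f z)"
      using abs_Re_le_cmod[of "cnj (f \<zeta>) * f z"] \<zeta>(2) by (simp add: H_def z_def norm_mult)
    then have "(H r)\<^sup>2 \<le> (norm (f z))\<^sup>2"
      using power_mono[of "\<bar>H r\<bar>" "norm (f z)" 2] by simp
    also have "\<dots> = r\<^sup>2 * (norm (h z))\<^sup>2"
      using h(2)[of z] z r by (simp add: norm_mult power_mult_distrib)
    also have "\<dots> \<le> r\<^sup>2 * (1 - k * (1 - r\<^sup>2))"
    proof (rule mult_left_mono)
      have "(1 - norm (h 0)) * (1 - r\<^sup>2) \<le> (1 + norm (h 0)) * (1 - (norm (h z))\<^sup>2)"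
        using Schwarz_Pick_origin[OF h(1) h(3), of z] z r by simp
      moreover have "0 < 1 + norm (h 0)"
        by (simp add: add_pos_nonneg)
      ultimately have "k * (1 - r\<^sup>2) \<le> 1 - (norm (h z))\<^sup>2"
        by (simp add: k_def pos_divide_le_eq mult.commute)
      then show "(norm (h z))\<^sup>2 \<le> 1 - k * (1 - r\<^sup>2)"
        by simp
    qed simp
    finally show ?thesis
      by (simp add: B_def)
  qed
  \<comment> \<open>A positive derivative at 1 would make \<open>B\<close> negative just to the left
    of 1.\<close>
  have "2 + 2 * k - 2 * m \<le> 0"
  proof (rule ccontr)
    assume "\<not> ?thesis"
    then obtain e where e: "e > 0" "\<And>t. 0 < t \<Longrightarrow> t < e \<Longrightarrow> B (1 - t) < B 1"
      using DERIV_pos_inc_left[OF B'] by auto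
    define t where "t = min e 1 / 2"
    have "0 < t" "t < e" "t < 1"
      using e(1) by (auto simp: t_def)
    then show False
      using e(2)[of t] Bpos[of "1 - t"] B1 by simp
  qed
  with k show ?thesis
    by (simp add: m_def)
qed

text \<open>On the punctured disk \<open>f\<close> is \<open>w / g w\<close>; the quotient rule puts
  \<open>(g z)\<^sup>2\<close> in the denominator of \<open>deriv f z\<close>, and the squared
  factor cancels it.\<close>

lemma z_over_sq_times_deriv:
  assumes f: "f \<in> class_U lam"
    and eq: "\<And>w. norm w < 1 \<Longrightarrow> z_over f w = g w"
    and g: "(g has_field_derivative g') (at z)"
    and z: "norm z < 1" "z \<noteq> 0"
  shows "(z_over f z)\<^sup>2 * deriv f z = g z - z * g'"
proof -
  have f_eq: "f w = w / g w" if "w \<in> ball 0 1 - {0}" for w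
  proof -
    have "g w = w / f w"
      using eq[of w] that by (simp add: z_over_def)
    then show ?thesis
      using that by simp
  qed
  have "f z \<noteq> 0"
    using f z by (auto simp: class_U_def)
  then have gz: "g z \<noteq> 0"
    using f_eq[of z] z by auto
  have "((\<lambda>w. w / g w) has_field_derivative (g z - z * g') / (g z)\<^sup>2) (at z)"
    using gz by (auto intro!: derivative_eq_intros g simp: power2_eq_square)
  then have "(f has_field_derivative (g z - z * g') / (g z)\<^sup>2) (at z)"
    by (rule has_field_derivative_transform_within_open[of _ _ _ "ball 0 1 - {0}"])
      (use z f_eq in auto)
  then show ?thesis
    using gz eq[of z] z by (simp add: DERIV_imp_deriv)
qed

text \<open>Radial limit. With \<open>c = 0\<close> it carries an identity from the disk to the
  circle; with \<open>c = lam\<close> it carries the defining inequality of the class to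
  \<open>\<zeta>\<close>.\<close>

lemma norm_le_at_boundary:
  fixes E :: "complex \<Rightarrow> complex"
  assumes "isCont E \<zeta>" and \<zeta>: "norm \<zeta> = 1"
    and le: "\<And>z. norm z < 1 \<Longrightarrow> z \<noteq> 0 \<Longrightarrow> norm (E z) \<le> c"
  shows "norm (E \<zeta>) \<le> c"
proof (rule tendsto_upperbound)
  have "((\<lambda>r. of_real r * \<zeta>) \<longlongrightarrow> of_real 1 * \<zeta>) (at_left (1::real))"
    by (intro tendsto_intros)
  then show "((\<lambda>r. norm (E (of_real r * \<zeta>))) \<longlongrightarrow> norm (E \<zeta>)) (at_left (1::real))"
    using assms(1) by (intro tendsto_norm isCont_tendsto_compose[of \<zeta> E]) auto
  have "eventually (\<lambda>r::real. r \<in> {0<..<1}) (at_left 1)"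
    by (rule eventually_at_leftI[of 0]) auto
  then show "eventually (\<lambda>r. norm (E (of_real r * \<zeta>)) \<le> c) (at_left (1::real))"
    by eventually_elim (use \<zeta> in \<open>auto intro!: le simp: norm_mult\<close>)
qed simp

theorem theorem2:
  fixes lam :: real and \<phi> f :: "complex \<Rightarrow> complex"
  assumes "0 < lam" and "lam \<le> 1"
    and "\<phi> analytic_on cball 0 1"
    and "\<phi> 0 = 0"
    and "\<forall>z \<in> ball 0 1. norm (\<phi> z) < 1"
    and "\<not> (\<exists>\<theta>::real. \<forall>z \<in> cball 0 1. \<phi> z = exp (\<i> * of_real \<theta>) * z)"
    and "\<exists>\<theta>\<^sub>0::real. \<phi> (exp (\<i> * of_real \<theta>\<^sub>0)) = -1"
    and "f 0 = 0"
    and "\<forall>z \<in> ball 0 1. z_over f z = 1 - (1 + of_real lam) * \<phi> z + of_real lam * (\<phi> z)\<^sup>2"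
  shows "f \<notin> class_U lam"
proof
  assume f: "f \<in> class_U lam"
  obtain \<theta> :: real where \<theta>: "\<phi> (exp (\<i> * of_real \<theta>)) = -1"
    using assms(7) by blast
  define \<zeta> where "\<zeta> = exp (\<i> * of_real \<theta>)"
  have \<zeta>: "norm \<zeta> = 1" "\<phi> \<zeta> = -1"
    using \<theta> by (simp_all add: \<zeta>_def)
  have der: "(\<phi> has_field_derivative deriv \<phi> z) (at z)" if "norm z \<le> 1" for z
    using assms(3) that
    by (metis analytic_on_imp_differentiable_at field_differentiable_derivI mem_cball_0)
  have holo: "\<phi> holomorphic_on ball 0 1"
    using assms(3) analytic_imp_holomorphic analytic_on_subset ball_subset_cball by blast
  \<comment> \<open>The hypothesis excludes rotations on the closed disk; by continuity a rotation
    on the open disk would also be one on the closed disk.\<close>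
  have nrot: "\<nexists>\<alpha>. norm \<alpha> = 1 \<and> (\<forall>z. norm z < 1 \<longrightarrow> \<phi> z = \<alpha> * z)"
  proof
    assume "\<exists>\<alpha>. norm \<alpha> = 1 \<and> (\<forall>z. norm z < 1 \<longrightarrow> \<phi> z = \<alpha> * z)"
    then obtain \<alpha> where \<alpha>: "norm \<alpha> = 1" "\<And>z. norm z < 1 \<Longrightarrow> \<phi> z = \<alpha> * z"
      by blast
    have "\<phi> z = exp (\<i> * of_real (Arg \<alpha>)) * z" if z: "z \<in> cball 0 1" for z
    proof -
      have "\<phi> z - \<alpha> * z = 0" if z: "norm z = 1"
      proof -
        have "isCont (\<lambda>z. \<phi> z - \<alpha> * z) z"
          using DERIV_isCont[OF der] z by (intro continuous_intros) auto
        then have "norm (\<phi> z - \<alpha> * z) \<le> 0"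
          by (rule norm_le_at_boundary) (use z \<alpha>(2) in auto)
        then show ?thesis
          by simp
      qed
      then have "\<phi> z = \<alpha> * z"
        using \<alpha>(2)[of z] z by (cases "norm z = 1") auto
      moreover have "\<alpha> = exp (\<i> * of_real (Arg \<alpha>))"
        using Arg_eq[of \<alpha>] \<alpha>(1) by fastforce
      ultimately show ?thesis
        by simp
    qed
    with assms(6) show False
      by blast
  qed
  \<comment> \<open>Here \<open>cnj (\<phi> \<zeta>) = -1\<close>, which reverses the sign of the
    boundary estimate.\<close>
  have Re_lt: "Re (\<zeta> * deriv \<phi> \<zeta>) < -1"
    using boundary_Schwarz_strict[OF holo assms(4) _ nrot \<zeta>(1) _ der] assms(5) \<zeta> by simp
  define g where "g z = 1 - (1 + of_real lam) * \<phi> z + of_real lam * (\<phi> z)\<^sup>2" for z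
  define g' where "g' z = (2 * of_real lam * \<phi> z - (1 + of_real lam)) * deriv \<phi> z" for z
  have g: "(g has_field_derivative g' z) (at z)" if "norm z \<le> 1" for z
    unfolding g_def g'_def
    by (auto intro!: derivative_eq_intros der that simp: algebra_simps)
  \<comment> \<open>Written through \<open>\<phi>\<close> alone, the quantity bounded in the class
    makes sense at \<open>\<zeta>\<close>, where nothing is known about \<open>f\<close>.\<close>
  define E where "E z = g z - z * g' z - 1" for z
  have "isCont (deriv \<phi>) \<zeta>"
    using analytic_at_imp_isCont analytic_deriv[OF assms(3)] analytic_on_analytic_at \<zeta>(1)
    by (metis mem_cball_0 order_refl)
  then have "isCont E \<zeta>"
    unfolding E_def g_def g'_def
    using DERIV_isCont[OF der, of \<zeta>] \<zeta>(1) by (intro continuous_intros) auto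
  moreover have "norm (E z) \<le> lam" if "norm z < 1" "z \<noteq> 0" for z
  proof -
    have "(z_over f z)\<^sup>2 * deriv f z = g z - z * g' z"
      by (rule z_over_sq_times_deriv[OF f _ g]) (use assms(9) that in \<open>auto simp: g_def\<close>)
    moreover have "norm ((z_over f z)\<^sup>2 * deriv f z - 1) < lam"
      using f that by (auto simp: class_U_def)
    ultimately show ?thesis
      by (simp add: E_def)
  qed
  ultimately have "norm (E \<zeta>) \<le> lam"
    using norm_le_at_boundary \<zeta>(1) by blast
  \<comment> \<open>The value \<open>\<phi> \<zeta> = -1\<close> gives
    \<open>g \<zeta> = 2 + 2 * lam\<close> and
    \<open>g' \<zeta> = - (1 + 3 * lam) * deriv \<phi> \<zeta>\<close>. Since
    \<open>(1 + 2 * lam) - (1 + 3 * lam) = - lam\<close>, the bound \<open>Re_lt\<close> is just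
    enough.\<close>
  moreover have "E \<zeta> = of_real (1 + 2 * lam) + of_real (1 + 3 * lam) * (\<zeta> * deriv \<phi> \<zeta>)"
    by (simp add: E_def g_def g'_def \<zeta>(2) algebra_simps)
  then have "Re (E \<zeta>) = 1 + 2 * lam + (1 + 3 * lam) * Re (\<zeta> * deriv \<phi> \<zeta>)"
    by (simp add: algebra_simps)
  moreover have "(1 + 3 * lam) * Re (\<zeta> * deriv \<phi> \<zeta>) < (1 + 3 * lam) * (-1)"
    by (rule mult_strict_left_mono[OF Re_lt]) (use assms(1) in simp)
  then have "(1 + 3 * lam) * Re (\<zeta> * deriv \<phi> \<zeta>) < - 1 - 3 * lam"
    by (simp only: mult_minus1_right)
  ultimately have "Re (E \<zeta>) < - lam"
    by linarith
  with \<open>norm (E \<zeta>) \<le> lam\<close> show False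
    using abs_Re_le_cmod[of "E \<zeta>"] by linarith
qed

end
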